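(* Over the field $\mathbb{F}_2$ with two elements, $\operatorname{Trank}(\det^4_{\mathbb{F}_2})=\operatorname{Trank}(\operatorname{per}^4_{\mathbb{F}_2})=12$.
   Context: $\det^4_{\mathbb{F}_2}=\sum_{\sigma\in S_4}\operatorname{sgn}(\sigma)\mathbf{e}_{\sigma(1)}\otimes\cdots\otimes\mathbf{e}_{\sigma(4)}$ and $\operatorname{per}^4_{\mathbb{F}_2}=\sum_{\sigma\in S_4}\mathbf{e}_{\sigma(1)}\otimes\cdots\otimes\mathbf{e}_{\sigma(4)}$ in $(\mathbb{F}_2^4)^{\otimes 4}$ (these coincide since $-1=1$); $\operatorname{Trank}$ is tensor rank (least number of elementary tensors $\mathbf{v_1}\otimes\mathbf{v_2}\otimes\mathbf{v_3}\otimes\mathbf{v_4}$ summing to the tensor). *)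

theory Defs
  imports
    "HOL-Analysis.Cartesian_Space"
    "HOL-Combinatorics.Permutations"
    "HOL-Library.Numeral_Type"
    "HOL-Library.Z2"
begin

text \<open>
  The tensor power of \<open>'a ^ 'n\<close> with factors indexed by \<open>'d\<close> is represented by coordinate
  arrays of type \<open>'a ^ ('d \<Rightarrow> 'n)\<close>: the entry at the multi-index \<open>f\<close> is the coefficient of
  the tensor product, over \<open>k :: 'd\<close>, of the standard basis vectors \<open>axis (f k) 1\<close>.
\<close>

definition elementary_tensor :: "('d::finite \<Rightarrow> 'a::comm_ring_1 ^ 'n) \<Rightarrow> 'a ^ ('d \<Rightarrow> 'n)" where
  "elementary_tensor v = (\<chi> f. \<Prod>k\<in>UNIV. v k $ f k)"

definition tensor_rank :: "'a::comm_ring_1 ^ ('d::finite \<Rightarrow> 'n::finite) \<Rightarrow> nat" where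
  "tensor_rank T =
     (LEAST r. \<exists>v :: nat \<Rightarrow> 'd \<Rightarrow> 'a ^ 'n. T = (\<Sum>i<r. elementary_tensor (v i)))"

definition det_tensor :: "'a::comm_ring_1 ^ ('n::finite \<Rightarrow> 'n)" where
  "det_tensor =
     (\<Sum>\<sigma> | \<sigma> permutes UNIV. of_int (sign \<sigma>) *s elementary_tensor (\<lambda>k. axis (\<sigma> k) 1))"

definition per_tensor :: "'a::comm_ring_1 ^ ('n::finite \<Rightarrow> 'n)" where
  "per_tensor = (\<Sum>\<sigma> | \<sigma> permutes UNIV. elementary_tensor (\<lambda>k. axis (\<sigma> k) 1))"

end

theory Submission imports Defs "HOL-Analysis.Determinants" begin

text \<open>
  Over \<open>F\<^sub>2\<close> the determinant and the permanent agree. The upper bound comes from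
  \<open>per = \<Sum>s. \<Otimes>k. (s + e\<^sub>k)\<close>, where \<open>s\<close> ranges over all vectors: the sum over \<open>s\<close> only retains the
  part of top degree in \<open>s\<close>, and the \<open>n\<close> terms with \<open>s = e\<^sub>k\<close> for some \<open>k\<close> vanish, which leaves
  \<open>2\<^sup>n - n\<close> terms.

  For the lower bound, read a decomposition into \<open>r\<close> terms as a representation of the determinant
  form as a sum of products of functionals, and let \<open>supp\<^sub>k u\<close> be the set of terms whose \<open>k\<close>-th
  functional does not vanish at \<open>u\<close>. Contracting the \<open>k\<close>-th slot with \<open>u \<noteq> 0\<close> gives a nonzero alternating
  trilinear form, so \<open>|supp\<^sub>k u| \<ge> 5\<close>. If equality holds, minimality forces the other functionals
  of these five terms to vanish at \<open>u\<close>, so \<open>supp\<^sub>l u\<close> is disjoint from \<open>supp\<^sub>k u\<close> for \<open>l \<noteq> k\<close>.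
  Suppose \<open>r \<le> 11\<close>. Averaging over \<open>u\<close> gives a \<open>u\<close> with \<open>|supp\<^sub>k u| = 5\<close>, and then all other \<open>supp\<^sub>l u\<close>
  coincide with the complement \<open>R\<close>, of size 6: a second support of size 5 would leave
  no room for the third. Inserting \<open>u\<close> into all slots but the \<open>k\<close>-th shows that \<open>|supp\<^sub>k y \<inter> R|\<close> is even for
  every \<open>y\<close>, while \<open>|supp\<^sub>k y| + |supp\<^sub>k (y - u)| \<ge> 10\<close> shows that it is at least 3, hence at least 4, for
  \<open>y \<notin> {0, u}\<close>. Summing over these 14 vectors gives \<open>56 \<le> 6 \<cdot> 8\<close>, a contradiction.
  The bound 5 for trilinear forms follows from the bound 2 for bilinear forms in the same way.
\<close>

section \<open>Arithmetic of the two-element field\<close>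

declare add_bit_eq_xor [simp del] mult_bit_eq_and [simp del]

instance bit :: finite
proof
  have "(UNIV :: bit set) = {0, 1}"
    by (auto intro: bit.exhaust)
  then show "finite (UNIV :: bit set)"
    by (metis finite.emptyI finite.insertI)
qed

lemma CARD_bit: "CARD(bit) = 2"
proof -
  have "(UNIV :: bit set) = {0, 1}"
    by (auto intro: bit.exhaust)
  then show ?thesis
    by (metis card_2_iff zero_neq_one)
qed

lemma bit_add_self: "a + a = (0 :: bit)"
  by (cases a) (simp_all)

lemma bit_add_eq_1_iff: "a + b = 1 \<longleftrightarrow> (a = 1) \<noteq> (b = (1 :: bit))"
  by (cases a; cases b) simp_all

lemma bit_add_eq_0_iff: "a + b = 0 \<longleftrightarrow> a = (b :: bit)"
  by (cases a; cases b) simp_all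

section \<open>Alternating forms over F_2 written as sums of products of functionals\<close>

definition multi_form :: "'k set \<Rightarrow> 'i set \<Rightarrow> ('i \<Rightarrow> 'k \<Rightarrow> 'v \<Rightarrow> bit) \<Rightarrow> ('k \<Rightarrow> 'v) \<Rightarrow> bit" where
  "multi_form K S v x = (\<Sum>i\<in>S. \<Prod>k\<in>K. v i k (x k))"

definition alternating :: "'k set \<Rightarrow> 'i set \<Rightarrow> ('i \<Rightarrow> 'k \<Rightarrow> 'v::ab_group_add \<Rightarrow> bit) \<Rightarrow> bool" where
  "alternating K S v \<longleftrightarrow> finite K \<and> finite S \<and> (\<forall>i\<in>S. \<forall>k\<in>K. additive (v i k)) \<and>
     (\<forall>x. \<not> inj_on x K \<longrightarrow> multi_form K S v x = 0)"

definition supp :: "'i set \<Rightarrow> ('i \<Rightarrow> 'k \<Rightarrow> 'v \<Rightarrow> bit) \<Rightarrow> 'k \<Rightarrow> 'v \<Rightarrow> 'i set" where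
  "supp S v k u = {i \<in> S. v i k u = 1}"

text \<open>The \<open>itself\<close> arguments record the types \<open>'v\<close> and
  \<open>'i\<close>, which otherwise occur only in the body; this lets the bound serve as a
  hypothesis of lemmas.\<close>

definition rank_at_least :: "'v::ab_group_add itself \<Rightarrow> 'i itself \<Rightarrow> 'k set \<Rightarrow> nat \<Rightarrow> bool" where
  "rank_at_least _ _ K m \<longleftrightarrow>
     (\<forall>(S :: 'i set) (v :: 'i \<Rightarrow> 'k \<Rightarrow> 'v \<Rightarrow> bit) x.
        alternating K S v \<longrightarrow> multi_form K S v x \<noteq> 0 \<longrightarrow> m \<le> card S)"

lemma rank_at_leastD:
  fixes v :: "'i \<Rightarrow> 'k \<Rightarrow> 'v::ab_group_add \<Rightarrow> bit"
  assumes "rank_at_least TYPE('v) TYPE('i) K m" "alternating K S v" "multi_form K S v x \<noteq> 0"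
  shows "m \<le> card S"
  using assms unfolding rank_at_least_def by blast

lemma alternatingD:
  assumes "alternating K S v"
  shows "finite K" "finite S" "\<And>i k. i \<in> S \<Longrightarrow> k \<in> K \<Longrightarrow> additive (v i k)"
    "\<And>x. \<not> inj_on x K \<Longrightarrow> multi_form K S v x = 0"
  using assms unfolding alternating_def by auto

lemma finite_supp: "finite S \<Longrightarrow> finite (supp S v k u)"
  by (simp add: supp_def)

lemma supp_subset: "supp S v k u \<subseteq> S"
  by (auto simp: supp_def)

lemma multi_form_remove:
  assumes "finite K" "k \<in> K"
  shows "multi_form K S v x = (\<Sum>i\<in>S. v i k (x k) * (\<Prod>l\<in>K - {k}. v i l (x l)))"
  unfolding multi_form_def by (intro sum.cong refl prod.remove assms)

lemma multi_form_upd: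
  assumes "finite K" "k \<in> K"
  shows "multi_form K S v (x(k := u)) = (\<Sum>i\<in>S. v i k u * (\<Prod>l\<in>K - {k}. v i l (x l)))"
  unfolding multi_form_remove[OF assms] by (auto intro!: sum.cong prod.cong)

text \<open>A coefficient in F_2 is 0 or 1, so fixing slot \<open>k\<close> simply selects the terms
  of the support.\<close>

lemma multi_form_contract:
  assumes "finite K" "finite S" "k \<in> K"
  shows "multi_form K S v (x(k := u)) = multi_form (K - {k}) (supp S v k u) v x"
proof -
  have "(\<Sum>i\<in>S. v i k u * (\<Prod>l\<in>K - {k}. v i l (x l))) =
        (\<Sum>i\<in>supp S v k u. \<Prod>l\<in>K - {k}. v i l (x l))"
    unfolding supp_def sum.inter_filter[OF assms(2)]
  proof (intro sum.cong refl)
    fix i show "v i k u * (\<Prod>l\<in>K - {k}. v i l (x l)) =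
        (if v i k u = 1 then (\<Prod>l\<in>K - {k}. v i l (x l)) else 0)"
      by (cases "v i k u") auto
  qed
  then show ?thesis
    unfolding multi_form_upd[OF assms(1,3)] by (simp add: multi_form_def)
qed

lemma multi_form_add:
  assumes "alternating K S v" "k \<in> K"
  shows "multi_form K S v (x(k := a + b)) = multi_form K S v (x(k := a)) + multi_form K S v (x(k := b))"
  unfolding multi_form_upd[OF alternatingD(1)[OF assms(1)] assms(2)] sum.distrib[symmetric]
  by (intro sum.cong refl)
    (simp add: additive.add[OF alternatingD(3)[OF assms(1) _ assms(2)]] algebra_simps)

lemma alternating_contract:
  fixes v :: "'i \<Rightarrow> 'k \<Rightarrow> 'v::ab_group_add \<Rightarrow> bit"
  assumes "alternating K S v" "k \<in> K"
  shows "alternating (K - {k}) (supp S v k u) v"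
  unfolding alternating_def
proof (intro conjI ballI allI impI)
  note A = alternatingD[OF assms(1)]
  show "finite (K - {k})" "finite (supp S v k u)"
    using A finite_supp by auto
  show "additive (v i l)" if "i \<in> supp S v k u" "l \<in> K - {k}" for i l
    using that A(3) supp_subset by fastforce
  fix x :: "'k \<Rightarrow> 'v" assume "\<not> inj_on x (K - {k})"
  then have "\<not> inj_on (x(k := u)) (K - {k})"
    using inj_on_cong[of "K - {k}" x "x(k := u)"] by auto
  then have "\<not> inj_on (x(k := u)) K"
    by (meson Diff_subset inj_on_subset)
  then show "multi_form (K - {k}) (supp S v k u) v x = 0"
    using A multi_form_contract[of K S k v x u] assms(2) by simp
qed

text \<open>Polarization: expand the vanishing value at \<open>a + b\<close> in both slots; the two
  diagonal terms vanish as well.\<close>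

lemma alternating_swap:
  assumes "alternating K S v" "k \<in> K" "l \<in> K" "k \<noteq> l"
  shows "multi_form K S v (x(k := b, l := a)) = multi_form K S v (x(k := a, l := b))"
proof -
  have z: "multi_form K S v (x(k := c, l := c)) = 0" for c
    by (rule alternatingD(4)[OF assms(1)]) (use assms in \<open>auto simp: inj_on_def\<close>)
  have "0 = multi_form K S v (x(k := a + b, l := a + b))"
    by (simp add: z)
  also have "\<dots> = multi_form K S v (x(k := a + b, l := a)) + multi_form K S v (x(k := a + b, l := b))"
    by (rule multi_form_add) fact+
  also have "\<dots> = multi_form K S v (x(k := b, l := a)) + multi_form K S v (x(k := a, l := b))"
    using multi_form_add[OF assms(1,2), of "x(l := a)" a b]
      multi_form_add[OF assms(1,2), of "x(l := b)" a b] z assms(4)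
    by (simp add: fun_upd_twist)
  finally show ?thesis
    by (metis bit_add_eq_0_iff)
qed

section \<open>The radical and minimal representations\<close>

definition nondegenerate_at ::
    "'k set \<Rightarrow> 'i set \<Rightarrow> ('i \<Rightarrow> 'k \<Rightarrow> 'v::ab_group_add \<Rightarrow> bit) \<Rightarrow> 'k \<Rightarrow> 'v \<Rightarrow> bool" where
  "nondegenerate_at K S v k u \<longleftrightarrow> (\<exists>x. multi_form K S v (x(k := u)) \<noteq> 0)"

lemma nondegenerate_at_any_slot:
  assumes "alternating K S v" "k \<in> K" "l \<in> K" "nondegenerate_at K S v k u"
  shows "nondegenerate_at K S v l u"
proof (cases "k = l")
  case False
  obtain x where x: "multi_form K S v (x(k := u)) \<noteq> 0"
    using assms(4) unfolding nondegenerate_at_def by blast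
  have "multi_form K S v (x(k := x l, l := u)) = multi_form K S v (x(k := u, l := x l))"
    by (rule alternating_swap) (use assms False in auto)
  also have "x(k := u, l := x l) = x(k := u)"
    using False by auto
  finally show ?thesis
    unfolding nondegenerate_at_def using x by metis
qed (use assms in simp)

text \<open>A representation with the minimal number of terms only involves functionals vanishing on
  the radical of the form: otherwise one term can be eliminated.\<close>

lemma minimal_vanishes_on_radical:
  fixes v :: "'i \<Rightarrow> 'k \<Rightarrow> 'v::ab_group_add \<Rightarrow> bit"
  assumes rank: "rank_at_least TYPE('v) TYPE('i) K m"
    and alt: "alternating K S v" and nz: "multi_form K S v x0 \<noteq> 0"
    and card: "card S \<le> m" and l: "l \<in> K"
    and radical: "\<And>x. multi_form K S v (x(l := u)) = 0"
    and i: "i \<in> S"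
  shows "v i l u = 0"
proof (rule ccontr)
  assume "v i l u \<noteq> 0"
  then have i1: "v i l u = 1"
    by simp
  note A = alternatingD[OF alt]
  \<comment> \<open>The radical condition is a linear relation between the products over
    \<open>K - {l}\<close>. As \<open>v i l u = 1\<close>, it can be solved for the product of term
    \<open>i\<close>; substituting the result gives \<open>v'\<close>.\<close>
  define v' where "v' j = (v j)(l := \<lambda>y. v j l y + v i l y * v j l u)" for j
  have same: "multi_form K (S - {i}) v' x = multi_form K S v x" for x
  proof -
    let ?g = "\<lambda>j. \<Prod>k\<in>K - {l}. v j k (x k)"
    have 0: "(\<Sum>j\<in>S. v j l u * ?g j) = 0"
      using radical[of x] by (simp add: multi_form_upd[OF A(1) l])
    have "multi_form K (S - {i}) v' x = (\<Sum>j\<in>S - {i}. (v j l (x l) + v i l (x l) * v j l u) * ?g j)"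
      unfolding multi_form_remove[OF A(1) l] by (auto simp: v'_def intro!: sum.cong prod.cong)
    also have "\<dots> = (\<Sum>j\<in>S. (v j l (x l) + v i l (x l) * v j l u) * ?g j)"
      using i1 by (simp add: sum.remove[OF A(2) i] bit_add_self)
    also have "\<dots> = (\<Sum>j\<in>S. v j l (x l) * ?g j) + v i l (x l) * (\<Sum>j\<in>S. v j l u * ?g j)"
      by (simp add: algebra_simps sum.distrib sum_distrib_left)
    finally show ?thesis
      by (simp add: 0 multi_form_remove[OF A(1) l])
  qed
  have "alternating K (S - {i}) v'"
    unfolding alternating_def same
  proof (intro conjI ballI allI impI)
    fix j k assume "j \<in> S - {i}" "k \<in> K"
    then have "additive (v j k)" "additive (v j l)" "additive (v i l)"
      using A(3) i l by auto
    then show "additive (v' j k)"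
      by (auto simp: v'_def additive_def algebra_simps)
  qed (use A in auto)
  then have "m \<le> card (S - {i})"
    using rank_at_leastD[OF rank, of "S - {i}" v' x0] nz same by simp
  then show False
    using card i A(2) by (metis card_Diff1_less leD le_trans)
qed

lemma card_supp_ge:
  fixes v :: "'i \<Rightarrow> 'k \<Rightarrow> 'v::ab_group_add \<Rightarrow> bit"
  assumes "rank_at_least TYPE('v) TYPE('i) (K - {k}) m" "alternating K S v" "k \<in> K"
    "nondegenerate_at K S v k u"
  shows "m \<le> card (supp S v k u)"
proof -
  obtain x where "multi_form K S v (x(k := u)) \<noteq> 0"
    using assms(4) unfolding nondegenerate_at_def by blast
  then have "multi_form (K - {k}) (supp S v k u) v x \<noteq> 0"
    using multi_form_contract[of K S k v x u] alternatingD[OF assms(2)] assms(3) by simp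
  then show ?thesis
    using rank_at_leastD[OF assms(1)] alternating_contract[OF assms(2,3)] by blast
qed

text \<open>Contracting slot \<open>k\<close> with \<open>u\<close> puts \<open>u\<close> into the
  radical of the remaining form, because \<open>u\<close> would then fill two slots. The contracted
  representation is minimal, so its functionals vanish at \<open>u\<close>.\<close>

lemma minimal_supp_disjoint:
  fixes v :: "'i \<Rightarrow> 'k \<Rightarrow> 'v::ab_group_add \<Rightarrow> bit"
  assumes rank: "rank_at_least TYPE('v) TYPE('i) (K - {k}) m" and alt: "alternating K S v"
    and k: "k \<in> K" and nd: "nondegenerate_at K S v k u"
    and min: "card (supp S v k u) \<le> m" and l: "l \<in> K" "l \<noteq> k"
  shows "supp S v l u \<inter> supp S v k u = {}"
proof -
  note A = alternatingD[OF alt]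
  obtain x where "multi_form K S v (x(k := u)) \<noteq> 0"
    using nd unfolding nondegenerate_at_def by blast
  then have nz: "multi_form (K - {k}) (supp S v k u) v x \<noteq> 0"
    using multi_form_contract[of K S k v x u] A k by simp
  have "multi_form (K - {k}) (supp S v k u) v (y(l := u)) = 0" for y
  proof -
    have "\<not> inj_on (y(l := u, k := u)) K"
      using k l by (auto simp: inj_on_def)
    then show ?thesis
      using multi_form_contract[of K S k v "y(l := u)" u] A k by simp
  qed
  then have "v i l u = 0" if "i \<in> supp S v k u" for i
    using minimal_vanishes_on_radical[OF rank alternating_contract[OF alt k] nz min] l that by blast
  then show ?thesis
    by (auto simp: supp_def)
qed

section \<open>Rank bounds for forms in two and three slots\<close>

lemma rank_at_least_1: "rank_at_least TYPE('v::ab_group_add) TYPE('i) (K :: 'k set) 1"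
  unfolding rank_at_least_def
proof (intro allI impI)
  fix S :: "'i set" and v :: "'i \<Rightarrow> 'k \<Rightarrow> 'v \<Rightarrow> bit" and x
  assume "alternating K S v" and nz: "multi_form K S v x \<noteq> 0"
  then have "finite S"
    by (simp add: alternatingD)
  moreover have "S \<noteq> {}"
    using nz by (auto simp: multi_form_def)
  ultimately show "1 \<le> card S"
    by (simp add: Suc_le_eq card_gt_0_iff)
qed

text \<open>With a single term, the supports of one vector in the two slots would be nonempty and
  disjoint.\<close>

lemma rank_at_least_2:
  fixes K :: "'k set"
  assumes "card K = 2"
  shows "rank_at_least TYPE('v::ab_group_add) TYPE('i) K 2"
  unfolding rank_at_least_def
proof (intro allI impI)
  fix S :: "'i set" and v :: "'i \<Rightarrow> 'k \<Rightarrow> 'v \<Rightarrow> bit" and x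
  assume alt: "alternating K S v" and nz: "multi_form K S v x \<noteq> 0"
  note A = alternatingD[OF alt]
  obtain k l where kl: "K = {k, l}" "k \<noteq> l"
    using assms by (meson card_2_iff)
  have nd: "nondegenerate_at K S v k (x k)"
    unfolding nondegenerate_at_def using nz by (metis fun_upd_triv)
  then have nd': "nondegenerate_at K S v l (x k)"
    using nondegenerate_at_any_slot[OF alt] kl by blast
  have c: "1 \<le> card (supp S v k (x k))" "1 \<le> card (supp S v l (x k))"
    using card_supp_ge[OF rank_at_least_1 alt] nd nd' kl by blast+
  show "2 \<le> card S"
  proof (rule ccontr)
    assume "\<not> 2 \<le> card S"
    then have "card (supp S v k (x k)) \<le> 1"
      using card_mono[OF A(2) supp_subset, of v k "x k"] by simp
    then have "supp S v l (x k) \<inter> supp S v k (x k) = {}"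
      using minimal_supp_disjoint[OF rank_at_least_1 alt _ nd, of l] kl by auto
    then have "card (supp S v l (x k)) + card (supp S v k (x k)) \<le> card S"
      using A(2) card_mono[OF A(2)] by (metis Un_least card_Un_disjoint finite_supp supp_subset)
    then show False
      using c \<open>\<not> 2 \<le> card S\<close> by simp
  qed
qed

text \<open>If the supports in slots \<open>k\<close> and \<open>l\<close> both had size
  \<open>m\<close>, a third slot would give three pairwise disjoint supports of size at least
  \<open>m\<close>, too many for \<open>S\<close>. Applied with \<open>m = 2\<close> and
  \<open>m = 5\<close>.\<close>

lemma other_supp_larger:
  fixes v :: "'i \<Rightarrow> 'k \<Rightarrow> 'v::ab_group_add \<Rightarrow> bit"
  assumes rank: "\<And>k. k \<in> K \<Longrightarrow> rank_at_least TYPE('v) TYPE('i) (K - {k}) m"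
    and alt: "alternating K S v"
    and k: "k \<in> K" and nd: "nondegenerate_at K S v k u"
    and min: "card (supp S v k u) \<le> m" and l: "l \<in> K" "l \<noteq> k"
    and K: "3 \<le> card K" and S: "card S < 3 * m"
  shows "supp S v l u \<subseteq> S - supp S v k u" "m < card (supp S v l u)"
proof -
  note A = alternatingD[OF alt]
  show *: "supp S v l u \<subseteq> S - supp S v k u"
    using minimal_supp_disjoint[OF rank[OF k] alt k nd min l] supp_subset by fast
  have ndl: "nondegenerate_at K S v p u" if "p \<in> K" for p
    using nondegenerate_at_any_slot[OF alt k that nd] .
  have ge: "m \<le> card (supp S v p u)" if "p \<in> K" for p
    using card_supp_ge[OF rank alt _ ndl] that by blast
  show "m < card (supp S v l u)"
  proof (rule ccontr)
    assume "\<not> m < card (supp S v l u)"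
    then have le: "card (supp S v l u) \<le> m"
      by simp
    have "card (K - {k, l}) \<noteq> 0"
      using K k l A(1) by (simp add: card_Diff_subset)
    then obtain p where p: "p \<in> K" "p \<noteq> k" "p \<noteq> l"
      by (metis Diff_iff card.empty ex_in_conv insertCI)
    have d: "supp S v p u \<inter> supp S v k u = {}" "supp S v p u \<inter> supp S v l u = {}"
      using minimal_supp_disjoint[OF rank[OF k] alt k nd min p(1,2)]
        minimal_supp_disjoint[OF rank[OF l(1)] alt l(1) ndl[OF l(1)] le p(1,3)] by auto
    have "card (supp S v p u \<union> (supp S v l u \<union> supp S v k u)) =
        card (supp S v p u) + (card (supp S v l u) + card (supp S v k u))"
      using d * A(2) by (subst card_Un_disjoint, auto simp: finite_supp)+
    moreover have "card (supp S v p u \<union> (supp S v l u \<union> supp S v k u)) \<le> card S"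
      using A(2) supp_subset by (metis Un_least card_mono)
    ultimately show False
      using S ge[OF k] ge[OF l(1)] ge[OF p(1)] by simp
  qed
qed

text \<open>Every element of the union lies in exactly two of the three sets.\<close>

lemma card_symdiff_triple:
  assumes "finite A" "finite B"
  shows "card A + card B + card ((A - B) \<union> (B - A)) = 2 * card (A \<union> B)"
proof -
  have "card A = card (A - B) + card (A \<inter> B)" "card B = card (B - A) + card (A \<inter> B)"
    using card_Int_Diff[OF assms(1), of B] card_Int_Diff[OF assms(2), of A]
    by (simp_all add: Int_commute)
  moreover have "card ((A - B) \<union> (B - A)) = card (A - B) + card (B - A)"
    using assms by (intro card_Un_disjoint) auto
  moreover have "card (A \<union> B) = card A + card (B - A)"
    using assms card_Un_disjoint[of A "B - A"] by simp
  ultimately show ?thesis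
    by simp
qed

text \<open>With at most 4 terms, a support of size 2 leaves no room for a larger disjoint one, so
  relevant supports have size at least 3. As \<open>'v\<close> may be infinite, the averaging is
  restricted to \<open>x k\<close>, \<open>x l\<close> and their sum: the three supports have total
  size at least 9, but each term lies in at most two of them, which allows only 8.\<close>

lemma rank_at_least_5:
  fixes K :: "'k set"
  assumes K: "card K = 3"
  shows "rank_at_least TYPE('v::ab_group_add) TYPE('i) K 5"
  unfolding rank_at_least_def
proof (intro allI impI, rule ccontr)
  fix S :: "'i set" and v :: "'i \<Rightarrow> 'k \<Rightarrow> 'v \<Rightarrow> bit" and x
  assume alt: "alternating K S v" and nz: "multi_form K S v x \<noteq> 0" and "\<not> 5 \<le> card S"
  then have S: "card S \<le> 4"
    by simp
  note A = alternatingD[OF alt]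
  have rank: "rank_at_least TYPE('v) TYPE('i) (K - {k}) 2" if "k \<in> K" for k
    using that K A(1) by (intro rank_at_least_2) simp
  obtain k l p where kl: "K = {k, l, p}" "k \<noteq> l" "p \<noteq> k" "p \<noteq> l"
    using K by (metis card_3_iff)
  have "card (supp S v k u) > 2" if nd: "nondegenerate_at K S v k u" for u
  proof (rule ccontr)
    assume "\<not> 2 < card (supp S v k u)"
    then have min: "card (supp S v k u) \<le> 2"
      by simp
    have "supp S v l u \<subseteq> S - supp S v k u" "2 < card (supp S v l u)"
      using other_supp_larger[OF rank alt _ nd min, of l] kl K S by auto
    then have "2 < card (S - supp S v k u)"
      using A(2) by (meson card_mono finite_Diff less_le_trans)
    moreover have "2 \<le> card (supp S v k u)"
      using card_supp_ge[OF rank alt _ nd] kl by auto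
    ultimately show False
      using S A(2) supp_subset[of S v k u] by (simp add: card_Diff_subset finite_supp)
  qed
  moreover have "nondegenerate_at K S v k (x k)"
    unfolding nondegenerate_at_def using nz by (metis fun_upd_triv)
  moreover have "nondegenerate_at K S v k (x l)"
  proof -
    have "nondegenerate_at K S v l (x l)"
      unfolding nondegenerate_at_def using nz by (metis fun_upd_triv)
    then show ?thesis
      using nondegenerate_at_any_slot[OF alt] kl by blast
  qed
  \<comment> \<open>Adding \<open>x l\<close> to slot \<open>k\<close> does not change the value,
    since the extra summand has a repeated argument.\<close>
  moreover have "nondegenerate_at K S v k (x k + x l)"
  proof -
    have "multi_form K S v (x(k := x l)) = 0"
      using kl by (intro A(4)) (auto simp: inj_on_def)
    then have "multi_form K S v (x(k := x k + x l)) \<noteq> 0"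
      using multi_form_add[OF alt, of k x "x k" "x l"] nz kl(1) by simp
    then show ?thesis
      unfolding nondegenerate_at_def by blast
  qed
  ultimately have "card (supp S v k (x k)) > 2" "card (supp S v k (x l)) > 2"
    "card (supp S v k (x k + x l)) > 2"
    by blast+
  moreover have "supp S v k (x k + x l) =
      (supp S v k (x k) - supp S v k (x l)) \<union> (supp S v k (x l) - supp S v k (x k))"
    using A(3)[of _ k] kl(1) by (auto simp: supp_def additive.add bit_add_eq_1_iff)
  moreover have "card (supp S v k (x k) \<union> supp S v k (x l)) \<le> 4"
    using S A(2) by (meson Un_least card_mono le_trans supp_subset)
  ultimately show False
    using card_symdiff_triple[of "supp S v k (x k)" "supp S v k (x l)"] A(2)
    by (simp add: finite_supp)
qed

section \<open>Averaging over a finite space and the bound for four slots\<close>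

lemma card_additive_eq_1:
  fixes g :: "'v::{ab_group_add, finite} \<Rightarrow> bit"
  assumes "additive g"
  shows "2 * card {u. g u = 1} \<le> CARD('v)"
proof (cases "\<exists>w. g w = 1")
  case True
  then obtain w where w: "g w = 1" ..
  \<comment> \<open>Translation by \<open>w\<close> carries the fibre over 1 into the fibre over
    0.\<close>
  have "inj_on (\<lambda>u. u + w) {u. g u = 1}" "(\<lambda>u. u + w) ` {u. g u = 1} \<subseteq> {u. g u = 0}"
    using additive.add[OF assms] w by (auto simp: inj_on_def)
  then have "card {u. g u = 1} \<le> card {u. g u = 0}"
    by (meson card_inj_on_le finite)
  moreover have "card {u. g u = 1} + card {u. g u = 0} = card ({u. g u = 1} \<union> {u. g u = 0})"
    by (intro card_Un_disjoint[symmetric]) auto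
  moreover have "\<dots> \<le> CARD('v)"
    by (intro card_mono) auto
  ultimately show ?thesis
    by simp
qed auto

text \<open>Double counting of pairs of a vector and a term. \<open>U\<close> is arbitrary so that
  exceptional vectors can be left out.\<close>

lemma sum_card_supp_le:
  fixes v :: "'i \<Rightarrow> 'k \<Rightarrow> 'v::{ab_group_add, finite} \<Rightarrow> bit"
  assumes "finite S" "\<And>i. i \<in> S \<Longrightarrow> additive (v i k)"
  shows "2 * (\<Sum>u\<in>U. card (supp S v k u)) \<le> CARD('v) * card S"
proof -
  have "(\<Sum>u\<in>U. card (supp S v k u)) = (\<Sum>u\<in>U. \<Sum>i\<in>S. if v i k u = 1 then 1 else 0)"
    using assms(1) by (simp add: supp_def sum.inter_filter[symmetric])
  also have "\<dots> = (\<Sum>i\<in>S. card {u \<in> U. v i k u = 1})"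
    by (subst sum.swap) (simp add: sum.inter_filter[symmetric])
  finally have "2 * (\<Sum>u\<in>U. card (supp S v k u)) = (\<Sum>i\<in>S. 2 * card {u \<in> U. v i k u = 1})"
    by (simp add: sum_distrib_left)
  also have "\<dots> \<le> (\<Sum>i\<in>S. CARD('v))"
  proof (rule sum_mono)
    fix i assume "i \<in> S"
    have "card {u \<in> U. v i k u = 1} \<le> card {u. v i k u = 1}"
      by (intro card_mono) auto
    then show "2 * card {u \<in> U. v i k u = 1} \<le> CARD('v)"
      using card_additive_eq_1[OF assms(2)[OF \<open>i \<in> S\<close>]] by simp
  qed
  finally show ?thesis
    by (simp add: mult.commute)
qed

lemma rank_ge_12:
  fixes v :: "'i \<Rightarrow> 'k \<Rightarrow> 'v::{ab_group_add, finite} \<Rightarrow> bit"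
  assumes alt: "alternating K S v" and K: "card K = 4" and V: "CARD('v) = 16"
    and k: "k \<in> K" and nd: "\<And>u. u \<noteq> 0 \<Longrightarrow> nondegenerate_at K S v k u"
  shows "12 \<le> card S"
proof (rule ccontr)
  assume "\<not> 12 \<le> card S"
  then have S: "card S \<le> 11"
    by simp
  note A = alternatingD[OF alt]
  have rank: "rank_at_least TYPE('v) TYPE('i) (K - {p}) 5" if "p \<in> K" for p
    using that K A(1) by (intro rank_at_least_5) simp
  have ge: "5 \<le> card (supp S v k u)" if "u \<noteq> 0" for u
    using card_supp_ge[OF rank alt k nd] that k by blast
  \<comment> \<open>Otherwise the 15 nonzero vectors would give 2 * 15 * 6 = 180, above the bound 16
    * 11 = 176.\<close>
  have "\<exists>u. u \<noteq> 0 \<and> card (supp S v k u) \<le> 5"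
  proof (rule ccontr)
    assume "\<not> ?thesis"
    then have "6 \<le> card (supp S v k u)" if "u \<in> - {0}" for u
      using that by (force simp: not_le Suc_le_eq)
    then have "6 * card (- {0 :: 'v}) \<le> (\<Sum>u\<in>- {0}. card (supp S v k u))"
      using sum_bounded_below[of "- {0}" 6 "\<lambda>u. card (supp S v k u)"]
      by (simp add: mult.commute)
    then show False
      using sum_card_supp_le[of S v k "- {0}"] A k V S by (simp add: Compl_eq_Diff_UNIV card_Diff_subset)
  qed
  then obtain u where u: "u \<noteq> 0" "card (supp S v k u) \<le> 5"
    by blast
  then have u5: "card (supp S v k u) = 5"
    using ge[of u] by simp
  define R where "R = S - supp S v k u"
  have cR: "card R = card S - 5"
    using A(2) supp_subset[of S v k u] u5 by (simp add: R_def card_Diff_subset finite_supp)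
  have finR: "finite R"
    using A(2) by (simp add: R_def)
  have R: "supp S v l u = R \<and> card R = 6" if l: "l \<in> K" "l \<noteq> k" for l
  proof -
    \<comment> \<open>Here 11 < 3 * 5. The support has at least 6 elements and \<open>R\<close> at
      most 11 - 5 = 6, so they agree.\<close>
    have "supp S v l u \<subseteq> R" "5 < card (supp S v l u)"
      using other_supp_larger[OF rank alt k nd u(2) l] K S u(1) by (auto simp: R_def)
    moreover from this have "card (supp S v l u) \<le> card R"
      using finR by (intro card_mono)
    ultimately show ?thesis
      using cR S finR by (intro conjI card_subset_eq) auto
  qed
  have "card (K - {k}) = 3"
    using K k A(1) by simp
  then obtain l p where lp: "l \<in> K" "p \<in> K" "l \<noteq> k" "p \<noteq> k" "l \<noteq> p"
    by (metis card_3_iff DiffE insertI1 insertI2 singletonI)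
  have cR6: "card R = 6"
    using R lp by blast
  have even: "even (card (supp R v k y))" for y
  proof -
    have "0 = multi_form K S v ((\<lambda>_. u)(k := y))"
      by (rule A(4)[symmetric]) (use lp in \<open>auto simp: inj_on_def\<close>)
    also have "\<dots> = (\<Sum>i\<in>S. v i k y * (\<Prod>l\<in>K - {k}. v i l u))"
      by (simp add: multi_form_upd[OF A(1) k])
    \<comment> \<open>On \<open>R\<close> all the other factors are 1; outside \<open>R\<close> the
      factor of slot \<open>l\<close> is 0.\<close>
    also have "\<dots> = (\<Sum>i\<in>S. if i \<in> supp R v k y then 1 else 0)"
    proof (rule sum.cong[OF refl])
      fix i assume i: "i \<in> S"
      show "v i k y * (\<Prod>l\<in>K - {k}. v i l u) = (if i \<in> supp R v k y then 1 else 0)"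
      proof (cases "i \<in> R")
        case True
        then have "v i q u = 1" if "q \<in> K - {k}" for q
          using R[of q] that by (auto simp: supp_def)
        then show ?thesis
          using True by (cases "v i k y") (auto simp: supp_def)
      next
        case False
        then have "v i l u = 0"
          using R[of l] lp i by (auto simp: supp_def)
        then have "(\<Prod>l\<in>K - {k}. v i l u) = 0"
          using lp A(1) by (intro prod_zero) auto
        then show ?thesis
          using False by (auto simp: supp_def)
      qed
    qed
    also have "\<dots> = of_nat (card (supp R v k y))"
    proof -
      have "{i \<in> S. i \<in> supp R v k y} = supp R v k y"
        by (auto simp: supp_def R_def)
      then show ?thesis
        using A(2) by (simp add: sum.inter_filter[symmetric])
    qed
    finally have "even (of_nat (card (supp R v k y)) :: bit)"
      by simp
    then show ?thesis
      by (simp only: even_of_nat_iff)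
  qed
  have "4 \<le> card (supp R v k y)" if y: "y \<noteq> 0" "y \<noteq> u" for y
  proof -
    let ?P = "supp S v k u"
    have add: "v i k (y - u) = v i k y + v i k u" if "i \<in> S" for i
      using additive.diff[OF A(3)[OF that k]] by simp
    have s1: "card (supp S v k y) = card (supp R v k y) + card (supp ?P v k y)"
      using A(2) by (subst card_Un_disjoint[symmetric])
        (auto simp: supp_def R_def intro: arg_cong[where f = card])
    \<comment> \<open>Passing from \<open>y\<close> to \<open>y - u\<close> keeps the part of the
      support inside \<open>R\<close> and complements the part inside \<open>?P\<close>. Adding
      \<open>s1\<close> and \<open>s2\<close> thus gives twice the part in \<open>R\<close> plus 5,
      which is at least 10.\<close>
    have s2: "card (supp S v k (y - u)) = card (supp R v k y) + card (?P - supp ?P v k y)"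
      using A(2) add by (subst card_Un_disjoint[symmetric])
        (auto simp: supp_def R_def bit_add_eq_1_iff intro!: arg_cong[where f = card])
    have s3: "card (supp ?P v k y) + card (?P - supp ?P v k y) = 5"
      using card_Diff_subset[of "supp ?P v k y" ?P] card_mono[of ?P "supp ?P v k y"] A(2)
        supp_subset[of ?P v k y] u5
      by (simp add: finite_supp)
    have "3 \<le> card (supp R v k y)"
      using s1 s2 s3 ge[of y] ge[of "y - u"] y by simp
    moreover have "card (supp R v k y) \<noteq> 3"
      using even[of y] by auto
    ultimately show ?thesis
      by simp
  qed
  then have "4 * card (- {0, u}) \<le> (\<Sum>y\<in>- {0, u}. card (supp R v k y))"
    using sum_bounded_below[of "- {0, u}" 4 "\<lambda>y. card (supp R v k y)"]
    by (auto simp: mult.commute)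
  moreover have "card (- {0, u}) = 14"
    using V u(1) by (simp add: Compl_eq_Diff_UNIV card_Diff_subset)
  moreover have "2 * (\<Sum>y\<in>- {0, u}. card (supp R v k y)) \<le> 16 * 6"
    using sum_card_supp_le[of R v k "- {0, u}"] finR A(3) k V cR6 by (simp add: R_def)
  ultimately show False
    by simp
qed

section \<open>From tensor decompositions to the determinant form\<close>

lemma sum_elementary_tensor_inner:
  fixes v :: "'i \<Rightarrow> 'd::finite \<Rightarrow> 'a::comm_ring_1 ^ 'n::finite"
  assumes "T = (\<Sum>i\<in>S. elementary_tensor (v i))"
  shows "(\<Sum>f\<in>UNIV. T $ f * (\<Prod>k\<in>UNIV. x k $ f k)) =
    (\<Sum>i\<in>S. \<Prod>k\<in>UNIV. \<Sum>j\<in>UNIV. v i k $ j * x k $ j)"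
proof -
  have "(\<Sum>f\<in>UNIV. T $ f * (\<Prod>k\<in>UNIV. x k $ f k)) =
    (\<Sum>f\<in>UNIV. \<Sum>i\<in>S. \<Prod>k\<in>UNIV. v i k $ f k * x k $ f k)"
    by (simp add: assms elementary_tensor_def sum_distrib_right prod.distrib)
  also have "\<dots> = (\<Sum>i\<in>S. \<Sum>f\<in>UNIV. \<Prod>k\<in>UNIV. v i k $ f k * x k $ f k)"
    by (rule sum.swap)
  also have "\<dots> = (\<Sum>i\<in>S. \<Prod>k\<in>UNIV. \<Sum>j\<in>UNIV. v i k $ j * x k $ j)"
    by (simp add: prod_sum_PiE PiE_UNIV_domain)
  finally show ?thesis .
qed

lemma permutes_UNIV_iff_bij: "\<sigma> permutes UNIV \<longleftrightarrow> bij \<sigma>"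
  by (auto intro: permutes_bij bij_imp_permutes)

lemma per_tensor_nth: "per_tensor $ f = (if bij f then 1 else 0)"
proof -
  have "(\<Prod>k\<in>UNIV. axis (\<sigma> k) (1 :: 'a) $ f k) = (if \<sigma> = f then 1 else 0)" for \<sigma> :: "'b \<Rightarrow> 'b"
  proof (cases "\<sigma> = f")
    case False
    then obtain k where "\<sigma> k \<noteq> f k"
      by blast
    then have "(\<Prod>k\<in>UNIV. axis (\<sigma> k) (1 :: 'a) $ f k) = 0"
      by (intro prod_zero bexI[of _ k]) (auto simp: axis_def)
    then show ?thesis
      using False by simp
  qed (simp add: axis_def)
  then show ?thesis
    by (simp add: per_tensor_def elementary_tensor_def permutes_UNIV_iff_bij)
qed

lemma of_int_sign_bit: "of_int (sign \<sigma>) = (1 :: bit)"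
  by (simp add: sign_def)

lemma det_tensor_eq_per_tensor_bit: "(det_tensor :: bit ^ ('n::finite \<Rightarrow> 'n)) = per_tensor"
  by (simp add: det_tensor_def per_tensor_def of_int_sign_bit)

lemma per_tensor_eval_bit:
  fixes x :: "'n::finite \<Rightarrow> bit ^ 'n"
  shows "(\<Sum>f\<in>UNIV. per_tensor $ f * (\<Prod>k\<in>UNIV. x k $ f k)) = det (\<chi> k. x k)"
proof -
  have "(\<Sum>f\<in>UNIV. per_tensor $ f * (\<Prod>k\<in>UNIV. x k $ f k)) =
    (\<Sum>f\<in>UNIV. if bij f then (\<Prod>k\<in>UNIV. x k $ f k) else 0)"
    by (intro sum.cong) (auto simp: per_tensor_nth)
  also have "\<dots> = (\<Sum>f | bij f. \<Prod>k\<in>UNIV. x k $ f k)"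
    by (simp add: sum.inter_filter[symmetric])
  finally show ?thesis
    by (simp add: det_def of_int_sign_bit permutes_UNIV_iff_bij)
qed

text \<open>The identity matrix with row \<open>j\<close> replaced by \<open>u\<close> has
  determinant \<open>u $ j\<close>. Choose \<open>j\<close> with a nonzero entry, then exchange rows
  \<open>j\<close> and \<open>k\<close>.\<close>

lemma det_nonzero_with_row:
  fixes u :: "'a::field ^ 'n::finite"
  assumes "u \<noteq> 0"
  shows "\<exists>x. x k = u \<and> det (\<chi> i. x i) \<noteq> 0"
proof -
  obtain j where j: "u $ j \<noteq> 0"
    using assms by (auto simp: vec_eq_iff)
  define A :: "'a ^ 'n ^ 'n" where "A = (\<chi> i. if i = j then u else row i (mat 1))"
  have u: "(\<Sum>i\<in>UNIV. u $ i *s row i (mat 1)) = u"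
    by (simp add: vec_eq_iff row_def mat_def if_distrib cong: if_cong)
  have "det A = u $ j"
    using cramer_lemma_transpose[of j u "mat 1"] unfolding A_def u by simp
  moreover have "det (\<chi> i. A $ Transposition.transpose k j i) = of_int (sign (Transposition.transpose k j)) * det A"
    by (intro det_permute_rows permutes_swap_id) auto
  ultimately have "det (\<chi> i. A $ Transposition.transpose k j i) \<noteq> 0"
    using j by (simp add: sign_def)
  then show ?thesis
    by (intro exI[of _ "\<lambda>i. A $ Transposition.transpose k j i"]) (simp add: A_def)
qed

lemma per_tensor_rank_ge_12:
  fixes r :: nat
  assumes "(per_tensor :: bit ^ (4 \<Rightarrow> 4)) = (\<Sum>i<r. elementary_tensor (v i))"
  shows "12 \<le> r"
proof -
  define w where "w i k y = (\<Sum>j\<in>UNIV. v i k $ j * y $ j)" for i k y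
  have eval: "multi_form UNIV {..<r} w x = det (\<chi> k. x k)" for x
    using sum_elementary_tensor_inner[OF assms, of x]
    by (simp add: multi_form_def w_def per_tensor_eval_bit)
  have "alternating UNIV {..<r} w"
    unfolding alternating_def eval
  proof (intro conjI ballI allI impI)
    show "additive (w i k)" for i k
      by (simp add: additive_def w_def algebra_simps sum.distrib)
    fix x :: "4 \<Rightarrow> bit ^ 4" assume "\<not> inj x"
    then obtain a b where "a \<noteq> b" "x a = x b"
      by (auto simp: inj_def)
    then show "det (\<chi> k. x k) = 0"
      by (intro det_identical_rows[of a b]) (auto simp: row_def)
  qed auto
  moreover have "nondegenerate_at UNIV {..<r} w 1 u" if u: "u \<noteq> 0" for u
  proof -
    obtain x where "x 1 = u" "det (\<chi> i. x i) \<noteq> 0"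
      using det_nonzero_with_row[OF u] by blast
    then show ?thesis
      unfolding nondegenerate_at_def eval by (metis fun_upd_triv)
  qed
  ultimately show ?thesis
    using rank_ge_12[of UNIV "{..<r}" w 1] by (simp add: CARD_bit)
qed

section \<open>An explicit decomposition for the upper bound\<close>

lemma prod_bit: "finite A \<Longrightarrow> (\<Prod>k\<in>A. g k) = (if \<forall>k\<in>A. g k = 1 then 1 else 0 :: bit)"
  by (induction A rule: finite_induct) auto

text \<open>The translation pairs vectors with \<open>j\<close>-th coordinate 0 and 1, and equal
  values cancel in characteristic 2.\<close>

lemma sum_translation_invariant_bit:
  fixes h :: "bit ^ 'n::finite \<Rightarrow> bit"
  assumes "\<And>s. h (s + axis j 1) = h s"
  shows "(\<Sum>s\<in>UNIV. h s) = 0"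
proof -
  have tt: "s + axis j 1 + axis j 1 = s" for s :: "bit ^ 'n"
    by (simp add: vec_eq_iff add.assoc bit_add_self)
  have "(\<Sum>s | s $ j = 1. h s) = (\<Sum>s | s $ j = 0. h s)"
    by (rule sum.reindex_bij_witness[where i = "\<lambda>s. s + axis j 1" and j = "\<lambda>s. s + axis j 1"])
      (simp_all add: tt assms axis_nth bit_add_self)
  moreover have "(\<Sum>s\<in>UNIV. h s) = (\<Sum>s | s $ j = 1. h s) + (\<Sum>s | s $ j = 0. h s)"
    by (subst sum.union_disjoint[symmetric]) (auto intro!: sum.cong)
  ultimately show ?thesis
    by (simp add: bit_add_self)
qed

text \<open>Checked entry by entry. For bijective \<open>f\<close> exactly one \<open>s\<close>
  contributes; if \<open>f\<close> misses \<open>j\<close>, the summand does not depend on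
  coordinate \<open>j\<close> of \<open>s\<close>, so the sum cancels.\<close>

lemma per_tensor_bit_eq_sum:
  "(per_tensor :: bit ^ ('n::finite \<Rightarrow> 'n)) = (\<Sum>s\<in>UNIV. elementary_tensor (\<lambda>k. s + axis k 1))"
proof (unfold vec_eq_iff, intro allI)
  fix f :: "'n \<Rightarrow> 'n"
  let ?h = "\<lambda>s :: bit ^ 'n. \<Prod>k\<in>UNIV. (s + axis k 1) $ f k"
  have "(\<Sum>s\<in>UNIV. ?h s) = (if bij f then 1 else 0)"
  proof (cases "bij f")
    case True
    \<comment> \<open>Solves the requirement that every factor be 1: at \<open>j = f k\<close>, the
      coordinate must be 1 plus that of \<open>axis k 1\<close>.\<close>
    define s0 :: "bit ^ 'n" where "s0 = (\<chi> j. 1 + axis (inv f j) 1 $ j)"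
    have "?h s = (if s = s0 then 1 else 0)" for s
    proof -
      have "(s + axis k 1) $ f k = 1 \<longleftrightarrow> s $ f k = s0 $ f k" for k
        using bij_is_inj[OF True] by (cases "s $ f k"; cases "axis k (1 :: bit) $ f k") (auto simp: s0_def)
      then have "(\<forall>k. (s + axis k 1) $ f k = 1) \<longleftrightarrow> (\<forall>k. s $ f k = s0 $ f k)"
        by blast
      also have "\<dots> \<longleftrightarrow> s = s0"
        unfolding vec_eq_iff using bij_is_surj[OF True] by (metis surjD)
      finally show ?thesis
        by (simp add: prod_bit)
    qed
    then show ?thesis
      using True by simp
  next
    case False
    then have "\<not> surj f"
      using finite_UNIV_surj_inj[of f] by (auto simp: bij_def)
    then obtain j where "\<And>k. f k \<noteq> j"
      unfolding surj_def by metis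
    then have "?h (s + axis j 1) = ?h s" for s
      by (intro prod.cong) (auto simp: axis_def)
    then show ?thesis
      using sum_translation_invariant_bit[of ?h j] False by simp
  qed
  then show "per_tensor $ f = (\<Sum>s\<in>UNIV. elementary_tensor (\<lambda>k. s + axis k (1 :: bit))) $ f"
    by (simp add: per_tensor_nth elementary_tensor_def)
qed

lemma per_tensor_bit_decomposition:
  "\<exists>v. (per_tensor :: bit ^ ('n::finite \<Rightarrow> 'n)) =
     (\<Sum>i < 2 ^ CARD('n) - CARD('n). elementary_tensor (v i))"
proof -
  \<comment> \<open>For \<open>s = axis k 1\<close> the \<open>k\<close>-th factor is zero, so only
    \<open>s\<close> in \<open>M\<close> matter; for \<open>n = 4\<close> this leaves 16 - 4 = 12
    terms.\<close>
  define M where "M = - range (\<lambda>k. axis k 1 :: bit ^ 'n)"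
  have "inj (\<lambda>k. axis k 1 :: bit ^ 'n)"
    by (auto simp: inj_def axis_eq_axis)
  then have card: "card M = 2 ^ CARD('n) - CARD('n)"
    by (simp add: M_def Compl_eq_Diff_UNIV card_Diff_subset card_image CARD_bit)
  have "elementary_tensor (\<lambda>k. s + axis k 1) = 0" if s: "s \<notin> M" for s :: "bit ^ 'n"
  proof -
    obtain k where "s = axis k 1"
      using s unfolding M_def by blast
    then have "(\<Prod>k\<in>UNIV. (s + axis k 1) $ f k) = 0" for f
      by (intro prod_zero bexI[of _ k]) (auto simp: bit_add_self)
    then show ?thesis
      by (simp add: elementary_tensor_def vec_eq_iff)
  qed
  then have "(per_tensor :: bit ^ ('n \<Rightarrow> 'n)) = (\<Sum>s\<in>M. elementary_tensor (\<lambda>k. s + axis k 1))"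
    unfolding per_tensor_bit_eq_sum by (intro sum.mono_neutral_right) auto
  moreover obtain h where h: "bij_betw h {..<card M} M"
    using ex_bij_betw_nat_finite[of M] by (auto simp: atLeast0LessThan)
  ultimately have "(per_tensor :: bit ^ ('n \<Rightarrow> 'n)) =
      (\<Sum>i<card M. elementary_tensor (\<lambda>k. h i + axis k 1))"
    by (simp add: sum.reindex_bij_betw[OF h, symmetric])
  then show ?thesis
    unfolding card by (rule exI[of _ "\<lambda>i k. h i + axis k 1"])
qed

theorem theorem6p4:
  shows "tensor_rank (det_tensor :: bit ^ (4 \<Rightarrow> 4)) = 12 \<and>
         tensor_rank (per_tensor :: bit ^ (4 \<Rightarrow> 4)) = 12"
proof -
  have "tensor_rank (per_tensor :: bit ^ (4 \<Rightarrow> 4)) = 12"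
    unfolding tensor_rank_def
  proof (rule Least_equality)
    show "\<exists>v. (per_tensor :: bit ^ (4 \<Rightarrow> 4)) = (\<Sum>i<12::nat. elementary_tensor (v i))"
      using per_tensor_bit_decomposition[where 'n = 4] by simp
  qed (use per_tensor_rank_ge_12 in blast)
  then show ?thesis
    by (simp add: det_tensor_eq_per_tensor_bit)
qed

end
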